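(* Consider a transmitting base station (the $i$-th TBS), a passive receiving base station (PBS), and a target located between the TBS and the PBS, traveling at an absolute velocity $\vec v$. When the space coordinate systems of the base stations and the target are unified, the total Doppler frequency shift at the PBS side is $$f_{i,\text{p}}=\frac{-v f_{\text{c}}}{c}\left[\cos\left(\theta-\phi_{\text{p},\text{ns}}^i\right)+\cos\left(\theta-\theta_{i,\text{ns}}\right)\right],\qquad \theta\in[0,2\pi),$$ where $v$ and $\theta$ are the magnitude and angle of the target's absolute velocity, respectively, $\theta_{i,\text{ns}}$ is the angle of departure (AoD) of the signal from the $i$-th TBS to the target, and $\phi_{\text{p},\text{ns}}^i$ is the angle of arrival (AoA) at the PBS of the signal reflected from the target.
   Context: There are $I$ transmitting base stations, indexed by $i\in\{1,\dots,I\}$, that transmit signals with carrier frequency $f_{\text{c}}$; $c$ is the speed of light. The signal of the $i$-th TBS reaches the PBS both directly (line-of-sight path) and after reflection by the target (called the NLoS path, subscript "ns"). $f_{i,\text{p}}$ denotes the Doppler frequency shift, caused by the motion of the target, of the echo signal received at the PBS over the path from the $i$-th TBS to the target to the PBS, relative to the signal transmitted by the $i$-th TBS. The angle $\theta$ of the target's velocity is measured counterclockwise. *)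

theory Defs
  imports "HOL-Analysis.Analysis"
begin

text \<open>
  Base stations and target lie in one common plane, identified with the complex numbers, so
  that every angle is measured counterclockwise from the same axis. A trajectory
  \<open>x :: real \<Rightarrow> complex\<close> gives the position of the target at each time; the base stations are fixed.

  The delay is the usual narrowband one: the length of the path from transmitter to target to
  receiver at time \<open>t\<close>, divided by the propagation speed. The displacement of the target while
  the signal is in flight is neglected; for speeds small against \<open>c\<close> it changes the Doppler shift
  only in second order.
\<close>

definition echo_delay :: "real \<Rightarrow> complex \<Rightarrow> complex \<Rightarrow> (real \<Rightarrow> complex) \<Rightarrow> real \<Rightarrow> real" where
  "echo_delay c tx rx x t = (dist tx (x t) + dist (x t) rx) / c"

definition carrier_phase :: "real \<Rightarrow> real \<Rightarrow> real" where
  "carrier_phase f\<^sub>c t = 2 * pi * f\<^sub>c * t"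

definition echo_phase ::
  "real \<Rightarrow> real \<Rightarrow> complex \<Rightarrow> complex \<Rightarrow> (real \<Rightarrow> complex) \<Rightarrow> real \<Rightarrow> real" where
  "echo_phase f\<^sub>c c tx rx x t = carrier_phase f\<^sub>c (t - echo_delay c tx rx x t)"

definition instantaneous_frequency :: "(real \<Rightarrow> real) \<Rightarrow> real \<Rightarrow> real" where
  "instantaneous_frequency \<psi> t = deriv \<psi> t / (2 * pi)"

definition doppler_shift ::
  "real \<Rightarrow> real \<Rightarrow> complex \<Rightarrow> complex \<Rightarrow> (real \<Rightarrow> complex) \<Rightarrow> real \<Rightarrow> real" where
  "doppler_shift f\<^sub>c c tx rx x t =
     instantaneous_frequency (echo_phase f\<^sub>c c tx rx x) t
     - instantaneous_frequency (carrier_phase f\<^sub>c) t"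

end

(* The distance from a fixed station changes at the rate of the component of the velocity along
   the line of sight, which is the speed times the cosine of the angle between the velocity and that
   line; each of the two legs of the path contributes one such term to the phase derivative. *)
theory Submission
  imports Defs
begin

text \<open>In polar form \<open>sgn z\<close> is \<open>cis \<beta>\<close>, so the inner product
  reduces to the subtraction formula for the cosine, scaled by \<open>norm w\<close>. If
  \<open>w = 0\<close>, every real is an argument of \<open>w\<close> and both sides vanish; a
  target at rest is thus covered.\<close>

lemma inner_sgn_is_Arg:
  assumes "is_Arg w \<alpha>" "is_Arg z \<beta>" "z \<noteq> 0"
  shows "w \<bullet> sgn z = norm w * cos (\<alpha> - \<beta>)"
proof -
  note w = assms(1)[unfolded is_Arg_def, folded cis_conv_exp]
    and z = assms(2)[unfolded is_Arg_def, folded cis_conv_exp]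
  have "sgn z = cis \<beta>"
    unfolding sgn_eq using arg_cong[OF z, of "\<lambda>u. u / complex_of_real (norm z)"] assms(3)
    by (metis nonzero_mult_div_cancel_left norm_eq_zero of_real_eq_0_iff)
  then have "w \<bullet> sgn z = (complex_of_real (norm w) * cis \<alpha>) \<bullet> cis \<beta>"
    using w by metis
  also have "\<dots> = norm w * cos (\<alpha> - \<beta>)"
    by (simp add: inner_complex_def cos_diff algebra_simps)
  finally show ?thesis .
qed

text \<open>Chain rule: away from the origin the norm has the unit vector \<open>sgn\<close> as its
  gradient.\<close>

lemma has_real_derivative_dist_const:
  fixes x :: "real \<Rightarrow> 'a::real_inner"
  assumes "(x has_vector_derivative u) (at t within S)" "x t \<noteq> a"
  shows "((\<lambda>s. dist (x s) a) has_real_derivative u \<bullet> sgn (x t - a)) (at t within S)"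
proof -
  have "((\<lambda>s. x s - a) has_derivative (\<lambda>h. h *\<^sub>R u)) (at t within S)"
    using assms(1) by (auto simp: has_vector_derivative_def intro!: derivative_eq_intros)
  moreover have "(norm has_derivative (\<lambda>h. h \<bullet> sgn (x t - a))) (at (x t - a))"
    using assms(2) by (simp add: has_derivative_norm)
  ultimately have "((\<lambda>s. norm (x s - a)) has_derivative (\<lambda>h. (h *\<^sub>R u) \<bullet> sgn (x t - a)))
      (at t within S)"
    by (rule has_derivative_compose)
  moreover have "(\<lambda>h. (h *\<^sub>R u) \<bullet> sgn (x t - a)) = (*) (u \<bullet> sgn (x t - a))"
    by (rule ext) (simp only: inner_scaleR_left mult.commute)
  ultimately show ?thesis
    by (simp only: has_field_derivative_def dist_norm)
qed

theorem theorem1: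
  fixes f\<^sub>c c t v \<theta> :: real
    and I i :: nat
    and tbs :: "nat \<Rightarrow> complex"
    and pbs vel :: complex
    and target :: "real \<Rightarrow> complex"
    and \<theta>_ns \<phi>_ns :: "nat \<Rightarrow> real"
  assumes "f\<^sub>c > 0" and "c > 0"
    and "i \<in> {1..I}"
    and "target t \<noteq> tbs i" and "target t \<noteq> pbs"
    and "(target has_vector_derivative vel) (at t)"
    and "v = norm vel" and "is_Arg vel \<theta>" and "\<theta> \<in> {0..<2 * pi}"
    and "is_Arg (target t - tbs i) (\<theta>_ns i)"
    and "is_Arg (target t - pbs) (\<phi>_ns i)"
  shows "doppler_shift f\<^sub>c c (tbs i) pbs target t =
    (- v * f\<^sub>c / c) * (cos (\<theta> - \<phi>_ns i) + cos (\<theta> - \<theta>_ns i))"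
proof -
  have tx: "((\<lambda>s. dist (tbs i) (target s)) has_real_derivative v * cos (\<theta> - \<theta>_ns i)) (at t)"
    using has_real_derivative_dist_const[OF assms(6,4)] inner_sgn_is_Arg[OF assms(8,10)] assms(4,7)
    by (simp add: dist_commute)
  \<comment> \<open>The angle of arrival is the direction in which the receiver sees the target,
    opposite to the propagation of the echo. Both unit vectors therefore point from a station to the
    target, and both cosines enter with the same sign.\<close>
  have rx: "((\<lambda>s. dist (target s) pbs) has_real_derivative v * cos (\<theta> - \<phi>_ns i)) (at t)"
    using has_real_derivative_dist_const[OF assms(6,5)] inner_sgn_is_Arg[OF assms(8,11)] assms(5,7)
    by simp
  \<comment> \<open>The summand 1 comes from the undelayed carrier and cancels in the shift; what
    remains is minus the growth rate of the path, times \<open>f\<^sub>c / c\<close>.\<close>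
  have "(echo_phase f\<^sub>c c (tbs i) pbs target has_real_derivative
      2 * pi * f\<^sub>c * (1 - (v * cos (\<theta> - \<theta>_ns i) + v * cos (\<theta> - \<phi>_ns i)) / c)) (at t)"
    unfolding echo_phase_def[abs_def] carrier_phase_def echo_delay_def
    by (intro DERIV_cmult DERIV_diff DERIV_ident DERIV_cdivide DERIV_add tx rx)
  moreover have "(carrier_phase f\<^sub>c has_real_derivative 2 * pi * f\<^sub>c) (at t)"
    unfolding carrier_phase_def[abs_def] by (auto intro!: derivative_eq_intros)
  ultimately show ?thesis
    using assms(2)
    by (simp add: doppler_shift_def instantaneous_frequency_def DERIV_imp_deriv field_simps)
qed

end
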